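(* Let $G$ and $H$ be finite pq-generated groups such that the power quandles $\mathrm{Pq}(G)$ and $\mathrm{Pq}(H)$ are isomorphic. Then $G\cong H$ as groups.
   Context: A power quandle $(P,\rhd,\pi,e)$ consists of a set $P$, a binary operation $\rhd$, an element $e$, and maps $\pi^n\colon P\to P$ ($n\in\mathbb{Z}$) satisfying: each $\lambda_a\colon b\mapsto a\rhd b$ is bijective and $a\rhd(b\rhd c)=(a\rhd b)\rhd(a\rhd c)$; $a\rhd a=a$; $e\rhd b=b$, $a\rhd e=e$; $\pi^1=\mathrm{id}$, $\pi^m\circ\pi^n=\pi^{mn}$; $\pi^0(a)=e$; $a\rhd\pi^n(b)=\pi^n(a\rhd b)$; $\pi^n(a)\rhd b=\lambda_a^n(b)$. An isomorphism of power quandles is a bijection preserving $\rhd$, all $\pi^n$ and $e$. For a group $G$, $\mathrm{Pq}(G)$ is the power quandle with $a\rhd b=aba^{-1}$, $\pi^n(a)=a^n$, unit the identity. For a power quandle $P$, $\mathrm{Gr}(P)$ is the group with generators $\sigma(a)$, $a\in P$, and relations $\sigma(a\rhd b)=\sigma(a)\sigma(b)\sigma(a)^{-1}$, $\sigma(\pi^n(a))=\sigma(a)^n$, $\sigma(e)=1$. A group $G$ is pq-generated if there exists a power quandle $P$ with $G\cong\mathrm{Gr}(P)$. *)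

theory Defs
  imports "HOL-Algebra.Algebra"
begin

record 'p pquandle =
  pq_carrier :: "'p set"
  pq_op :: "'p \<Rightarrow> 'p \<Rightarrow> 'p"
  pq_pi :: "int \<Rightarrow> 'p \<Rightarrow> 'p"
  pq_e :: "'p"

definition lam_pow :: "'p pquandle \<Rightarrow> 'p \<Rightarrow> int \<Rightarrow> 'p \<Rightarrow> 'p" where
  "lam_pow P a n b =
     (if 0 \<le> n then (pq_op P a ^^ nat n) b
      else (inv_into (pq_carrier P) (pq_op P a) ^^ nat (- n)) b)"

definition power_quandle :: "'p pquandle \<Rightarrow> bool" where
  "power_quandle P \<longleftrightarrow>
     (pq_e P \<in> pq_carrier P \<and>
      (\<forall>a\<in>pq_carrier P. \<forall>b\<in>pq_carrier P. pq_op P a b \<in> pq_carrier P) \<and>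
      (\<forall>n. \<forall>a\<in>pq_carrier P. pq_pi P n a \<in> pq_carrier P) \<and>
      (\<forall>a\<in>pq_carrier P. bij_betw (pq_op P a) (pq_carrier P) (pq_carrier P)) \<and>
      (\<forall>a\<in>pq_carrier P. \<forall>b\<in>pq_carrier P. \<forall>c\<in>pq_carrier P. pq_op P a (pq_op P b c) = pq_op P (pq_op P a b) (pq_op P a c)) \<and>
      (\<forall>a\<in>pq_carrier P. pq_op P a a = a) \<and>
      (\<forall>b\<in>pq_carrier P. pq_op P (pq_e P) b = b) \<and>
      (\<forall>a\<in>pq_carrier P. pq_op P a (pq_e P) = pq_e P) \<and>
      (\<forall>a\<in>pq_carrier P. pq_pi P 1 a = a) \<and>
      (\<forall>m n. \<forall>a\<in>pq_carrier P. pq_pi P m (pq_pi P n a) = pq_pi P (m * n) a) \<and>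
      (\<forall>a\<in>pq_carrier P. pq_pi P 0 a = pq_e P) \<and>
      (\<forall>n. \<forall>a\<in>pq_carrier P. \<forall>b\<in>pq_carrier P. pq_op P a (pq_pi P n b) = pq_pi P n (pq_op P a b)) \<and>
      (\<forall>n. \<forall>a\<in>pq_carrier P. \<forall>b\<in>pq_carrier P. pq_op P (pq_pi P n a) b = lam_pow P a n b))"

definition pq_iso :: "'p pquandle \<Rightarrow> 'q pquandle \<Rightarrow> bool" where
  "pq_iso P Q \<longleftrightarrow>
     (\<exists>f. bij_betw f (pq_carrier P) (pq_carrier Q) \<and>
          (\<forall>a\<in>pq_carrier P. \<forall>b\<in>pq_carrier P. f (pq_op P a b) = pq_op Q (f a) (f b)) \<and>
          (\<forall>n. \<forall>a\<in>pq_carrier P. f (pq_pi P n a) = pq_pi Q n (f a)) \<and>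
          f (pq_e P) = pq_e Q)"

definition Pq :: "('g, 'm) monoid_scheme \<Rightarrow> 'g pquandle" where
  "Pq G = \<lparr> pq_carrier = carrier G,
            pq_op = (\<lambda>a b. monoid.mult G (monoid.mult G a b) (m_inv G a)),
            pq_pi = (\<lambda>(n::int) a. pow G a n),
            pq_e = one G \<rparr>"

text \<open>Words: letters (a, True) stand for sigma(a), (a, False) for sigma(a)^-1.\<close>

definition pw :: "'p \<Rightarrow> int \<Rightarrow> ('p * bool) list" where
  "pw a n = (if 0 \<le> n then replicate (nat n) (a, True) else replicate (nat (- n)) (a, False))"

definition words :: "'p set \<Rightarrow> ('p * bool) list set" where
  "words S = {w. \<forall>l\<in>set w. fst l \<in> S}"

inductive gr_eq :: "'p pquandle \<Rightarrow> ('p * bool) list \<Rightarrow> ('p * bool) list \<Rightarrow> bool"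
  for P where
  gr_refl: "w \<in> words (pq_carrier P) \<Longrightarrow> gr_eq P w w"
| gr_sym: "gr_eq P x y \<Longrightarrow> gr_eq P y x"
| gr_trans: "gr_eq P x y \<Longrightarrow> gr_eq P y z \<Longrightarrow> gr_eq P x z"
| gr_cong: "gr_eq P x y \<Longrightarrow> u \<in> words (pq_carrier P) \<Longrightarrow> v \<in> words (pq_carrier P)
             \<Longrightarrow> gr_eq P (u @ x @ v) (u @ y @ v)"
| gr_cancel: "a \<in> pq_carrier P \<Longrightarrow> gr_eq P [(a, s), (a, \<not> s)] []"
| gr_conj: "a \<in> pq_carrier P \<Longrightarrow> b \<in> pq_carrier P \<Longrightarrow>
             gr_eq P [(pq_op P a b, True)] [(a, True), (b, True), (a, False)]"
| gr_pow: "a \<in> pq_carrier P \<Longrightarrow> gr_eq P [(pq_pi P n a, True)] (pw a n)"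
| gr_unit: "gr_eq P [(pq_e P, True)] []"

definition gr_rel :: "'p pquandle \<Rightarrow> (('p * bool) list \<times> ('p * bool) list) set" where
  "gr_rel P = {(x, y). gr_eq P x y}"

definition Gr :: "'p pquandle \<Rightarrow> ('p * bool) list set monoid" where
  "Gr P = \<lparr> carrier = words (pq_carrier P) // gr_rel P,
            monoid.mult = (\<lambda>A B. gr_rel P `` {(SOME x. x \<in> A) @ (SOME y. y \<in> B)}),
            one = gr_rel P `` {[]} \<rparr>"

end

theory Submission
  imports Defs
begin

text \<open>
  Let \<open>f\<close> be an isomorphism from \<open>Pq G\<close> to \<open>Pq H\<close> and let \<open>E\<close> be the subgroup of \<open>G \<times> H\<close> generated by
  the graph of \<open>f\<close>. Whenever \<open>(x, y) \<in> E\<close>, the map \<open>f\<close> carries conjugation by \<open>x\<close> to conjugation by \<open>y\<close>;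
  hence the kernels \<open>K \<subseteq> H\<close> and \<open>L \<subseteq> G\<close> of the two projections of \<open>E\<close> are central. Since \<open>G\<close> is
  pq-generated, \<open>f\<close> on the generators extends to a homomorphism \<open>G \<rightarrow> H\<close> whose graph lies in \<open>E\<close>, so
  that \<open>E \<cong> G \<times> K\<close>, and symmetrically \<open>E \<cong> H \<times> L\<close>. As \<open>f\<close> preserves powers, \<open>G\<close> and \<open>H\<close> have the same
  number of solutions of \<open>x\<^sup>n = 1\<close> for each \<open>n\<close>; therefore so do \<open>K\<close> and \<open>L\<close>, which are thus isomorphic
  as finite abelian groups. Finite groups can be cancelled from direct products (Lovasz), so \<open>G \<cong> H\<close>.
\<close>

section \<open>Cancellation of finite direct factors\<close>

text \<open>Extensionality makes each homomorphism on \<open>carrier T\<close> a single function, so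
  that cardinalities count homomorphisms. The set \<open>N\<close> is an arbitrary subset, so that
  the counts can be inverted over the whole lattice of subsets.\<close>

definition homs_killing :: "('x, 'a) monoid_scheme \<Rightarrow> ('g, 'b) monoid_scheme \<Rightarrow> 'x set \<Rightarrow> ('x \<Rightarrow> 'g) set" where
  "homs_killing T G N = {h \<in> hom T G \<inter> extensional (carrier T). N \<subseteq> kernel T G h}"

definition homs_with_kernel :: "('x, 'a) monoid_scheme \<Rightarrow> ('g, 'b) monoid_scheme \<Rightarrow> 'x set \<Rightarrow> ('x \<Rightarrow> 'g) set" where
  "homs_with_kernel T G N = {h \<in> hom T G \<inter> extensional (carrier T). kernel T G h = N}"

lemma finite_extensional_homs:
  assumes "finite (carrier T)" "finite (carrier G)"
  shows "finite (hom T G \<inter> extensional (carrier T))"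
proof (rule finite_subset)
  show "hom T G \<inter> extensional (carrier T) \<subseteq> carrier T \<rightarrow>\<^sub>E carrier G"
    by (auto simp: hom_def PiE_def)
  show "finite (carrier T \<rightarrow>\<^sub>E carrier G)"
    using assms by (simp add: finite_PiE)
qed

text \<open>Each homomorphism counted on the left has exactly one kernel, which lies between
  \<open>N\<close> and \<open>carrier T\<close>.\<close>

lemma card_homs_killing_eq_sum:
  assumes "finite (carrier T)" "finite (carrier G)"
  shows "card (homs_killing T G N) =
    (\<Sum>M | N \<subseteq> M \<and> M \<subseteq> carrier T. card (homs_with_kernel T G M))"
proof -
  have "homs_killing T G N = (\<Union>M \<in> {M. N \<subseteq> M \<and> M \<subseteq> carrier T}. homs_with_kernel T G M)"
    by (auto simp: homs_killing_def homs_with_kernel_def kernel_def)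
  moreover have "finite (homs_with_kernel T G M)" for M
    by (rule finite_subset[OF _ finite_extensional_homs[OF assms]]) (auto simp: homs_with_kernel_def)
  moreover have "finite {M. N \<subseteq> M \<and> M \<subseteq> carrier T}"
    by (rule finite_subset[of _ "Pow (carrier T)"]) (use assms in auto)
  ultimately show ?thesis
    by (simp, intro card_UN_disjoint) (auto simp: homs_with_kernel_def)
qed

text \<open>Moebius inversion over subsets, carried out as an induction descending from
  \<open>carrier T\<close>: in the sum over all \<open>M\<close> containing \<open>N\<close>, the
  terms with \<open>M\<close> larger than \<open>N\<close> agree by induction, which leaves the term
  for \<open>N\<close>.\<close>

lemma card_homs_with_kernel_cong:
  assumes fin: "finite (carrier T)" "finite (carrier G)" "finite (carrier H)"
    and eq: "\<And>N. N \<subseteq> carrier T \<Longrightarrow> card (homs_killing T G N) = card (homs_killing T H N)"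
    and "N \<subseteq> carrier T"
  shows "card (homs_with_kernel T G N) = card (homs_with_kernel T H N)"
  using \<open>N \<subseteq> carrier T\<close>
proof (induction "card (carrier T - N)" arbitrary: N rule: less_induct)
  case less
  let ?S = "{M. N \<subseteq> M \<and> M \<subseteq> carrier T}"
  have S: "finite ?S" "N \<in> ?S"
    using less.prems fin(1) by (auto intro: finite_subset[of _ "Pow (carrier T)"])
  have "card (homs_with_kernel T G M) = card (homs_with_kernel T H M)" if "M \<in> ?S - {N}" for M
  proof (rule less.hyps)
    show "card (carrier T - M) < card (carrier T - N)"
      using that fin(1) by (intro psubset_card_mono) auto
  qed (use that in auto)
  then have "(\<Sum>M\<in>?S - {N}. card (homs_with_kernel T G M)) = (\<Sum>M\<in>?S - {N}. card (homs_with_kernel T H M))"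
    by (rule sum.cong[OF refl])
  moreover have "(\<Sum>M\<in>?S. card (homs_with_kernel T G M)) = (\<Sum>M\<in>?S. card (homs_with_kernel T H M))"
    using eq[OF less.prems] by (simp add: card_homs_killing_eq_sum fin)
  ultimately show ?case
    by (simp add: sum.remove[OF S])
qed

lemma homs_killing_compose:
  assumes "monoid T" "f \<in> hom A B" "f \<one>\<^bsub>A\<^esub> = \<one>\<^bsub>B\<^esub>" "h \<in> homs_killing T A N"
  shows "(\<lambda>x\<in>carrier T. f (h x)) \<in> homs_killing T B N"
proof -
  interpret T: monoid T by fact
  have "h \<in> hom T A" "N \<subseteq> kernel T A h"
    using assms(4) by (auto simp: homs_killing_def)
  then have "(\<lambda>x\<in>carrier T. f (h x)) \<in> hom T B" "N \<subseteq> kernel T B (\<lambda>x\<in>carrier T. f (h x))"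
    using assms(2,3) by (auto simp: hom_def kernel_def Pi_iff)
  then show ?thesis
    by (simp add: homs_killing_def)
qed

text \<open>This is the universal property of the product: a map into
  \<open>A \<times>\<times> B\<close> is a pair of maps, and it kills \<open>N\<close> exactly when
  both components do.\<close>

lemma card_homs_killing_DirProd:
  assumes "monoid T"
  shows "card (homs_killing T (A \<times>\<times> B) N) = card (homs_killing T A N) * card (homs_killing T B N)"
proof -
  interpret T: monoid T by fact
  let ?F = "\<lambda>(h, k). \<lambda>x\<in>carrier T. (h x, k x)"
  let ?G = "\<lambda>u. (\<lambda>x\<in>carrier T. fst (u x), \<lambda>x\<in>carrier T. snd (u x))"
  have "bij_betw ?F (homs_killing T A N \<times> homs_killing T B N) (homs_killing T (A \<times>\<times> B) N)"
  proof (rule bij_betw_byWitness[where f' = ?G])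
    show "\<forall>a\<in>homs_killing T A N \<times> homs_killing T B N. ?G (?F a) = a"
      by (force simp: homs_killing_def extensional_def fun_eq_iff)
    show "\<forall>a\<in>homs_killing T (A \<times>\<times> B) N. ?F (?G a) = a"
      by (force simp: homs_killing_def extensional_def fun_eq_iff)
    show "?F ` (homs_killing T A N \<times> homs_killing T B N) \<subseteq> homs_killing T (A \<times>\<times> B) N"
      by (auto simp: homs_killing_def kernel_def hom_def Pi_def subset_iff)
    have "fst \<in> hom (A \<times>\<times> B) A" "snd \<in> hom (A \<times>\<times> B) B"
      by (auto simp: hom_def)
    then show "?G ` homs_killing T (A \<times>\<times> B) N \<subseteq> homs_killing T A N \<times> homs_killing T B N"
      by (intro image_subsetI SigmaI homs_killing_compose[OF assms, of _ "A \<times>\<times> B"]) simp_all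
  qed
  from bij_betw_same_card[OF this] show ?thesis
    by (simp add: card_cartesian_product)
qed

lemma card_homs_killing_iso:
  assumes "monoid T" "group A" "group B" "A \<cong> B"
  shows "card (homs_killing T A N) = card (homs_killing T B N)"
proof -
  obtain f g where iso: "group_isomorphisms A B f g"
    using assms group.iso_iff_group_isomorphisms is_iso_def by blast
  then have homs: "f \<in> hom A B" "f \<one>\<^bsub>A\<^esub> = \<one>\<^bsub>B\<^esub>" "g \<in> hom B A" "g \<one>\<^bsub>B\<^esub> = \<one>\<^bsub>A\<^esub>"
    using assms hom_one by (auto simp: group_isomorphisms_def)
  have "bij_betw (\<lambda>h. \<lambda>x\<in>carrier T. f (h x)) (homs_killing T A N) (homs_killing T B N)"
  proof (rule bij_betw_byWitness[where f' = "\<lambda>h. \<lambda>x\<in>carrier T. g (h x)"])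
    show "\<forall>h\<in>homs_killing T A N. (\<lambda>x\<in>carrier T. g ((\<lambda>x\<in>carrier T. f (h x)) x)) = h"
      "\<forall>h\<in>homs_killing T B N. (\<lambda>x\<in>carrier T. f ((\<lambda>x\<in>carrier T. g (h x)) x)) = h"
      using iso by (auto simp: group_isomorphisms_def homs_killing_def hom_def extensional_def fun_eq_iff)
  qed (use homs_killing_compose[OF assms(1)] homs in auto)
  then show ?thesis
    by (rule bij_betw_same_card)
qed

text \<open>
  The kernel-refined counts recover the number of injective homomorphisms \<open>G \<rightarrow> H\<close> from the numbers of
  homomorphisms killing given subsets, and the latter are multiplicative in the target.
\<close>
theorem DirProd_cancel_right:
  assumes "group G" "group H" "group K"
    and fin: "finite (carrier G)" "finite (carrier H)" "finite (carrier K)"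
    and iso: "G \<times>\<times> K \<cong> H \<times>\<times> K"
  shows "G \<cong> H"
proof -
  interpret G: group G by fact
  interpret H: group H by fact
  interpret K: group K by fact
  have "card (homs_killing G G N) = card (homs_killing G H N)" if "N \<subseteq> carrier G" for N
  proof -
    \<comment> \<open>The trivial homomorphism makes the factor contributed by \<open>K\<close>
      nonzero, so that it can be cancelled.\<close>
    have "(\<lambda>x\<in>carrier G. \<one>\<^bsub>K\<^esub>) \<in> homs_killing G K N"
      using that by (auto simp: homs_killing_def kernel_def hom_def)
    moreover have "finite (homs_killing G K N)"
      by (rule finite_subset[OF _ finite_extensional_homs[OF fin(1,3)]]) (auto simp: homs_killing_def)
    ultimately have "card (homs_killing G K N) \<noteq> 0"
      by auto
    moreover have "card (homs_killing G (G \<times>\<times> K) N) = card (homs_killing G (H \<times>\<times> K) N)"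
      using iso by (intro card_homs_killing_iso DirProd_group assms G.is_monoid)
    ultimately show ?thesis
      by (simp add: card_homs_killing_DirProd G.is_monoid)
  qed
  then have "card (homs_with_kernel G G {\<one>\<^bsub>G\<^esub>}) = card (homs_with_kernel G H {\<one>\<^bsub>G\<^esub>})"
    using fin by (intro card_homs_with_kernel_cong) auto
  \<comment> \<open>The identity of \<open>G\<close> witnesses that the count of injective
    homomorphisms is nonzero; hence \<open>G\<close> also embeds in \<open>H\<close>.\<close>
  moreover have "(\<lambda>x\<in>carrier G. x) \<in> homs_with_kernel G G {\<one>\<^bsub>G\<^esub>}"
    by (auto simp: homs_with_kernel_def kernel_def hom_def)
  moreover have "finite (homs_with_kernel G G {\<one>\<^bsub>G\<^esub>})"
    by (rule finite_subset[OF _ finite_extensional_homs[OF fin(1,1)]]) (auto simp: homs_with_kernel_def)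
  ultimately have "card (homs_with_kernel G H {\<one>\<^bsub>G\<^esub>}) \<noteq> 0"
    by (metis card_eq_0_iff empty_iff)
  then obtain h where h: "h \<in> hom G H" "kernel G H h = {\<one>\<^bsub>G\<^esub>}"
    by (auto simp: homs_with_kernel_def) (metis (mono_tags, lifting) card.empty empty_Collect_eq less_not_refl)
  interpret group_hom G H h
    by unfold_locales (rule h)
  have inj: "inj_on h (carrier G)"
    using trivial_ker_imp_inj h(2) by simp
  have "card (carrier G) * card (carrier K) = card (carrier H) * card (carrier K)"
    using iso_same_card[OF iso] by (simp add: card_cartesian_product)
  moreover have "card (carrier K) \<noteq> 0"
    using fin(3) K.one_closed by auto
  ultimately have "card (h ` carrier G) = card (carrier H)"
    using inj by (simp add: card_image)
  then have "h ` carrier G = carrier H"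
    using fin(2) by (intro card_subset_eq) auto
  then show ?thesis
    using h(1) inj by (intro is_isoI isoI) (auto simp: bij_betw_def)
qed

section \<open>Finite abelian groups are determined by their torsion counts\<close>

text \<open>Merely a set: in a nonabelian group these solutions need not form a subgroup. For
  \<open>n = 0\<close> it is the whole carrier.\<close>

definition torsion :: "('g, 'a) monoid_scheme \<Rightarrow> nat \<Rightarrow> 'g set" where
  "torsion G n = {x \<in> carrier G. x [^]\<^bsub>G\<^esub> n = \<one>\<^bsub>G\<^esub>}"

lemma DirProd_nat_pow: "(x, y) [^]\<^bsub>G \<times>\<times> H\<^esub> (n::nat) = (x [^]\<^bsub>G\<^esub> n, y [^]\<^bsub>H\<^esub> n)"
  by (induction n) auto

lemma torsion_DirProd: "torsion (G \<times>\<times> H) n = torsion G n \<times> torsion H n"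
  by (auto simp: torsion_def DirProd_nat_pow)

text \<open>The bijection is not assumed to be multiplicative, so this serves both group
  isomorphisms and power quandle isomorphisms.\<close>

lemma card_torsion_bij:
  assumes bij: "bij_betw f (carrier G) (carrier H)"
    and eq: "\<And>x. x \<in> carrier G \<Longrightarrow> f x [^]\<^bsub>H\<^esub> n = \<one>\<^bsub>H\<^esub> \<longleftrightarrow> x [^]\<^bsub>G\<^esub> n = \<one>\<^bsub>G\<^esub>"
  shows "card (torsion G n) = card (torsion H n)"
proof -
  have "torsion H n = {y \<in> f ` carrier G. y [^]\<^bsub>H\<^esub> n = \<one>\<^bsub>H\<^esub>}"
    by (simp add: torsion_def bij_betw_imp_surj_on[OF bij])
  also have "\<dots> = f ` {x \<in> carrier G. f x [^]\<^bsub>H\<^esub> n = \<one>\<^bsub>H\<^esub>}"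
    by blast
  also have "\<dots> = f ` torsion G n"
    by (simp add: torsion_def eq cong: conj_cong)
  finally have "bij_betw f (torsion G n) (torsion H n)"
    by (intro bij_betw_subset[OF bij]) (auto simp: torsion_def)
  then show ?thesis
    by (rule bij_betw_same_card)
qed

lemma card_torsion_iso:
  assumes "group G" "group H" "G \<cong> H"
  shows "card (torsion G n) = card (torsion H n)"
proof -
  obtain f where f: "f \<in> iso G H"
    using assms by (auto simp: is_iso_def)
  interpret group_hom G H f
    using f assms by (simp add: group_hom_def group_hom_axioms_def iso_def)
  have bij: "bij_betw f (carrier G) (carrier H)"
    using f by (simp add: iso_def)
  have "f x [^]\<^bsub>H\<^esub> n = \<one>\<^bsub>H\<^esub> \<longleftrightarrow> x [^]\<^bsub>G\<^esub> n = \<one>\<^bsub>G\<^esub>" if "x \<in> carrier G" for x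
    using that bij by (metis G.nat_pow_closed G.one_closed bij_betw_def hom_nat_pow hom_one inj_on_eq_iff)
  then show ?thesis
    by (rule card_torsion_bij[OF bij])
qed

lemma (in group) torsion_nonempty: "torsion G n \<noteq> {}"
  by (auto simp: torsion_def)

section \<open>Elements of maximal order and cyclic direct factors\<close>

text \<open>By Bezout, \<open>x\<close> is a product of powers of its \<open>m\<close>-th and
  \<open>n\<close>-th powers.\<close>

lemma (in group) mem_subgroup_of_coprime_pows:
  assumes "subgroup M G" "x \<in> carrier G" "x [^] (m::int) \<in> M" "x [^] (n::int) \<in> M" "coprime m n"
  shows "x \<in> M"
proof -
  obtain u v where uv: "u * m + v * n = 1"
    using assms(5) bezout_int[of m n] by (auto simp: coprime_iff_gcd_eq_1)
  have "x = x [^] (m * u + n * v)"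
    using uv assms(2) by (simp add: mult.commute)
  also have "\<dots> = (x [^] m) [^] u \<otimes> (x [^] n) [^] v"
    using assms(2) by (simp add: int_pow_mult int_pow_pow)
  also have "\<dots> \<in> M"
    using assms by (meson subgroup.m_closed subgroup_int_pow_closed)
  finally show ?thesis .
qed

lemma (in comm_group) ord_mult_coprime:
  assumes "x \<in> carrier G" "y \<in> carrier G" "coprime (ord x) (ord y)"
  shows "ord (x \<otimes> y) = ord x * ord y"
proof (rule dvd_antisym)
  let ?m = "ord (x \<otimes> y)"
  have xy: "x [^] ?m \<otimes> y [^] ?m = \<one>"
    using assms pow_ord_eq_1[of "x \<otimes> y"] by (simp add: nat_pow_distrib del: pow_ord_eq_1)
  \<comment> \<open>Raising to the power \<open>ord v\<close> removes \<open>v\<close>, and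
    coprimality then removes the factor \<open>ord v\<close>. Stated for \<open>u\<close> and
    \<open>v\<close> so that it applies with \<open>x\<close> and \<open>y\<close> in either
    order.\<close>
  have *: "ord u dvd ?m" if "u \<in> carrier G" "v \<in> carrier G" "coprime (ord u) (ord v)"
    "u [^] ?m \<otimes> v [^] ?m = \<one>" for u v
  proof -
    have "u [^] (?m * ord v) \<otimes> v [^] (?m * ord v) = (u [^] ?m \<otimes> v [^] ?m) [^] ord v"
      using that(1,2) by (simp add: nat_pow_distrib nat_pow_pow)
    moreover have "v [^] (?m * ord v) = \<one>"
      using that(2) by (simp add: pow_eq_id)
    ultimately have "u [^] (?m * ord v) = \<one>"
      using that by simp
    then show ?thesis
      using that by (simp add: pow_eq_id coprime_dvd_mult_left_iff)
  qed
  show "ord x * ord y dvd ?m"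
    using assms xy by (intro divides_mult *[of x y] *[of y x]) (auto simp: coprime_commute m_comm)
qed (use assms abelian_ord_mul_divides in auto)

text \<open>If a prime \<open>p\<close> divided \<open>ord x\<close> to a higher power than
  \<open>ord a\<close>, then the \<open>p\<close>-part of \<open>x\<close> times the part of
  \<open>a\<close> prime to \<open>p\<close> would have order larger than
  \<open>ord a\<close>.\<close>

lemma (in comm_group) ord_dvd_maximal_ord:
  assumes fin: "finite (carrier G)" and a: "a \<in> carrier G"
    and max: "\<And>y. y \<in> carrier G \<Longrightarrow> ord y \<le> ord a" and x: "x \<in> carrier G"
  shows "ord x dvd ord a"
proof (rule ccontr)
  assume ndvd: "\<not> ord x dvd ord a"
  have pos: "ord a \<noteq> 0" "ord x \<noteq> 0"
    using ord_ge_1[OF fin] a x by (metis not_one_le_zero)+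
  obtain p where p: "Factorial_Ring.prime p" "multiplicity p (ord a) < multiplicity p (ord x)"
    using ndvd pos multiplicity_le_imp_dvd[of "ord x" "ord a"] by (metis not_le)
  let ?e = "multiplicity p (ord x)" and ?f = "multiplicity p (ord a)"
  \<comment> \<open>These have the coprime orders \<open>p ^ ?e\<close> and
    \<open>ord a div p ^ ?f\<close>.\<close>
  let ?x = "x [^] (ord x div p ^ ?e)" and ?a = "a [^] (p ^ ?f)"
  have "ord x div p ^ ?e dvd ord x"
    by (metis dvd_div_mult_self dvd_triv_left multiplicity_dvd)
  then have "ord ?x = p ^ ?e"
    using pos x by (subst ord_pow) (auto simp: multiplicity_dvd div_div_eq_right dvd_div_eq_0_iff)
  moreover have oa: "ord ?a = ord a div p ^ ?f"
    using a p by (intro ord_pow) (auto simp: multiplicity_dvd)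
  moreover have "\<not> p dvd ord a div p ^ ?f"
    using pos p by (intro multiplicity_decompose) auto
  ultimately have "ord (?x \<otimes> ?a) = p ^ ?e * (ord a div p ^ ?f)"
    using p a x by (subst ord_mult_coprime) (auto intro: prime_imp_coprime)
  moreover have "p ^ ?f * (ord a div p ^ ?f) < p ^ ?e * (ord a div p ^ ?f)"
    using p pos prime_gt_1_nat[OF p(1)]
    by (intro mult_strict_right_mono power_strict_increasing) (auto simp: multiplicity_dvd dvd_imp_le div_greater_zero_iff)
  ultimately have "ord a < ord (?x \<otimes> ?a)"
    by (simp add: multiplicity_dvd)
  with max[of "?x \<otimes> ?a"] a x show False
    by simp
qed

lemma (in comm_group) exists_ord_eq_exponent:
  assumes fin: "finite (carrier G)"
  obtains a where "a \<in> carrier G" "\<And>x. x \<in> carrier G \<Longrightarrow> ord x dvd ord a"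
proof -
  have "Max (ord ` carrier G) \<in> ord ` carrier G"
    using fin by (intro Max_in) auto
  then obtain a where a: "a \<in> carrier G" "ord a = Max (ord ` carrier G)"
    by auto
  show ?thesis
    using that[OF a(1)] ord_dvd_maximal_ord[OF fin a(1)] fin by (simp add: a(2))
qed

text \<open>
  A subgroup \<open>B\<close> maximal with trivial intersection with \<open>\<langle>a\<rangle>\<close> is a complement: otherwise some \<open>x\<close> outside
  \<open>\<langle>a\<rangle>B\<close> has \<open>x\<^sup>p\<close> in it for a prime \<open>p\<close>, and after multiplying \<open>x\<close> by a power of \<open>a\<close> one gets \<open>x\<^sup>p \<in> B\<close>,
  so that \<open>B\<langle>x\<rangle>\<close> contradicts maximality.
\<close>
lemma (in comm_group) cyclic_subgroup_complement:
  assumes fin: "finite (carrier G)" and a: "a \<in> carrier G"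
    and exp: "\<And>x. x \<in> carrier G \<Longrightarrow> ord x dvd ord a"
  obtains B where "subgroup B G" "generate G {a} \<inter> B \<subseteq> {\<one>}" "generate G {a} <#> B = carrier G"
proof -
  let ?A = "generate G {a}"
  have A: "subgroup ?A G"
    using a by (intro generate_is_subgroup) auto
  let ?S = "{B. subgroup B G \<and> ?A \<inter> B \<subseteq> {\<one>}}"
  have "finite ?S"
    by (rule finite_subset[of _ "Pow (carrier G)"]) (use fin subgroup.subset in auto)
  moreover have "{\<one>} \<in> ?S"
    using triv_subgroup by auto
  ultimately have "\<exists>B\<in>?S. \<forall>B'\<in>?S. B \<subseteq> B' \<longrightarrow> B = B'"
    by (intro finite_has_maximal) auto
  then obtain B where "B \<in> ?S" and Bmax: "\<forall>B'\<in>?S. B \<subseteq> B' \<longrightarrow> B = B'"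
    by (rule bexE)
  from \<open>B \<in> ?S\<close> have B: "subgroup B G" "?A \<inter> B \<subseteq> {\<one>}"
    by auto
  let ?M = "?A <#> B"
  have M: "subgroup ?M G"
    using A B mult_subgroups by auto
  have AM: "?A \<subseteq> ?M" and BM: "B \<subseteq> ?M"
    using subgroup.one_closed[OF A] subgroup.one_closed[OF B(1)] subgroup.mem_carrier[OF A]
      subgroup.mem_carrier[OF B(1)] unfolding set_mult_def by force+
  have "?M = carrier G"
  proof (rule ccontr)
    assume "?M \<noteq> carrier G"
    then obtain z where z: "z \<in> carrier G" "z \<notin> ?M"
      using subgroup.subset[OF M] by blast
    \<comment> \<open>Minimality of \<open>m\<close> keeps the power \<open>m div p\<close> of
      \<open>z\<close> outside \<open>?M\<close> for any prime \<open>p\<close> dividing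
      \<open>m\<close>, while the \<open>p\<close>-th power of that element is inside.\<close>
    define m where "m = (LEAST m::nat. m > 0 \<and> z [^] m \<in> ?M)"
    have "ord z > 0 \<and> z [^] ord z \<in> ?M"
      using z ord_ge_1[OF fin z(1)] subgroup.one_closed[OF M] by auto
    then have m: "m > 0" "z [^] m \<in> ?M"
      unfolding m_def by (metis (mono_tags, lifting) LeastI)+
    have "m \<noteq> 1"
      using m z by auto
    then obtain p where p: "Factorial_Ring.prime p" "p dvd m"
      using prime_factor_nat by blast
    let ?x = "z [^] (m div p)"
    have "m div p < m" "m div p > 0"
      using p m prime_gt_1_nat[OF p(1)] by (auto simp: dvd_imp_le div_greater_zero_iff prime_gt_0_nat)
    then have x: "?x \<in> carrier G" "?x \<notin> ?M"
      using z not_less_Least[of "m div p" "\<lambda>m. m > 0 \<and> z [^] m \<in> ?M"] by (auto simp: m_def)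
    have xp: "?x [^] p \<in> ?M"
      using m z p by (simp add: nat_pow_pow)
    \<comment> \<open>Otherwise the coprime exponents \<open>p\<close> and \<open>ord a\<close>
      would both send \<open>?x\<close> into \<open>?M\<close>, and hence \<open>?x\<close> itself
      would lie there.\<close>
    have pn: "p dvd ord a"
    proof (rule ccontr)
      assume "\<not> p dvd ord a"
      then have "coprime (int p) (int (ord a))"
        using p prime_imp_coprime by auto
      moreover have "?x [^] ord a = \<one>"
        using x exp by (simp only: pow_eq_id)
      then have "?x [^] int (ord a) \<in> ?M"
        using subgroup.one_closed[OF M] by (simp add: int_pow_int)
      ultimately show False
        using mem_subgroup_of_coprime_pows[OF M x(1)] xp x(2) by (metis int_pow_int)
    qed
    obtain i b where ib: "b \<in> B" "?x [^] p = a [^] (i::int) \<otimes> b"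
      using xp generate_pow[OF a] by (auto simp: set_mult_def)
    have bc: "b \<in> carrier G"
      using ib B subgroup.mem_carrier by fast
    let ?n = "int (ord a div p)"
    \<comment> \<open>Since \<open>ord a\<close> is an exponent of \<open>G\<close>, this power is
      trivial; so a power of \<open>a\<close> lies in \<open>B\<close> and must be
      \<open>\<one>\<close>. Comparing orders gives that \<open>p\<close> divides
      \<open>i\<close>.\<close>
    have "(a [^] i \<otimes> b) [^] ?n = ?x [^] (ord a)"
      using x pn by (simp add: int_pow_int nat_pow_pow flip: ib(2))
    also have "\<dots> = \<one>"
      using exp x by (simp add: pow_eq_id)
    finally have "a [^] (i * ?n) \<otimes> b [^] ?n = \<one>"
      using a bc by (simp add: int_pow_distrib int_pow_pow)
    then have "a [^] (i * ?n) = inv (b [^] ?n)"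
      using a bc by (simp add: inv_equality)
    also have "\<dots> \<in> B"
      using ib B by (simp add: subgroup.m_inv_closed subgroup_int_pow_closed)
    finally have "a [^] (i * ?n) = \<one>"
      using B(2) generate_pow[OF a] by auto
    then have "int (ord a) dvd i * ?n"
      using a int_pow_eq_id by simp
    moreover have "int (ord a) = int p * ?n" "?n \<noteq> 0"
      using pn ord_ge_1[OF fin a] by (auto simp flip: of_nat_mult)
    ultimately have "int p dvd i"
      by simp
    then obtain j where j: "i = int p * j" ..
    \<comment> \<open>Correcting by the power \<open>- j\<close> of \<open>a\<close> cancels the
      \<open>a\<close>-component of the \<open>p\<close>-th power, which becomes \<open>b\<close>,
      and keeps the element outside \<open>?M\<close>.\<close>
    define y where "y = ?x \<otimes> a [^] (- j)"
    have y: "y \<in> carrier G"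
      using a x by (simp add: y_def)
    have xy: "?x = y \<otimes> a [^] j"
      using a x by (simp add: y_def m_assoc int_pow_neg)
    have yM: "y \<notin> ?M"
    proof
      assume "y \<in> ?M"
      moreover have "a [^] j \<in> ?M"
        using AM generate_pow[OF a] by blast
      ultimately show False
        using x(2) xy subgroup.m_closed[OF M] by metis
    qed
    have "y [^] int p = ?x [^] int p \<otimes> a [^] (- i)"
      unfolding y_def j using a x(1) by (subst int_pow_distrib) (simp_all add: int_pow_pow mult.commute)
    then have yp: "y [^] int p = b"
      using a bc ib by (simp add: int_pow_int int_pow_neg m_assoc m_comm[of "a [^] i"])
    let ?B = "B <#> generate G {y}"
    have "subgroup ?B G"
      using B y mult_subgroups generate_is_subgroup by auto
    moreover have "?A \<inter> ?B \<subseteq> {\<one>}"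
    proof
      fix c assume c: "c \<in> ?A \<inter> ?B"
      then obtain b' r where r: "b' \<in> B" "c = b' \<otimes> y [^] (r::int)"
        using generate_pow[OF y] by (auto simp: set_mult_def)
      have b'c: "b' \<in> carrier G"
        using r B subgroup.mem_carrier by fast
      have "y [^] r = inv b' \<otimes> c"
        using r y b'c by (simp flip: m_assoc)
      also have "\<dots> \<in> ?M"
        using c r AM BM by (meson IntD1 M subgroup.m_closed subgroup.m_inv_closed subsetD)
      \<comment> \<open>If \<open>r\<close> were prime to \<open>p\<close>, the powers
        \<open>r\<close> and \<open>p\<close> of \<open>y\<close> in \<open>?M\<close> would force
        \<open>y\<close> into \<open>?M\<close>.\<close>
      finally have "\<not> coprime (int p) r"
        using mem_subgroup_of_coprime_pows[OF M y] yp ib(1) BM yM by auto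
      then obtain k where "r = int p * k"
        using p prime_imp_coprime[of "int p" r] by auto
      then have "y [^] r \<in> B"
        using yp y ib B by (metis int_pow_pow subgroup_int_pow_closed)
      then have "c \<in> B"
        using r B by (simp add: subgroup.m_closed)
      then show "c \<in> {\<one>}"
        using c B by auto
    qed
    moreover have "B \<subseteq> ?B" "y \<in> ?B"
      using B y subgroup.one_closed[OF B(1)] subgroup.mem_carrier[OF B(1)]
        generate.one[of G "{y}"] generate.incl[of y "{y}" G] unfolding set_mult_def by force+
    ultimately show False
      using bspec[OF Bmax, of ?B] BM yM by auto
  qed
  then show ?thesis
    using that B by blast
qed

text \<open>Sending powers of \<open>a\<close> to the same powers of \<open>b\<close> is well
  defined and injective, since equality of powers depends only on the order.\<close>

lemma cyclic_subgroups_iso: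
  assumes "group G" "group H" "a \<in> carrier G" "b \<in> carrier H" "group.ord G a = group.ord H b"
  shows "subgroup_generated G (generate G {a}) \<cong> subgroup_generated H (generate H {b})"
proof -
  interpret G: group G by fact
  interpret H: group H by fact
  have sub: "subgroup (generate G {a}) G" "subgroup (generate H {b}) H"
    using assms G.generate_is_subgroup H.generate_is_subgroup by auto
  \<comment> \<open>The exponent is determined only modulo the order of \<open>a\<close>; by the
    next fact any choice gives the same value.\<close>
  define f where "f = (\<lambda>x. b [^]\<^bsub>H\<^esub> (SOME k::int. x = a [^]\<^bsub>G\<^esub> k))"
  have eq: "a [^]\<^bsub>G\<^esub> k = a [^]\<^bsub>G\<^esub> l \<longleftrightarrow> b [^]\<^bsub>H\<^esub> k = b [^]\<^bsub>H\<^esub> l" for k l :: int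
    using assms by (simp add: G.int_pow_eq H.int_pow_eq)
  have f: "f (a [^]\<^bsub>G\<^esub> k) = b [^]\<^bsub>H\<^esub> k" for k :: int
    unfolding f_def by (rule someI2[of _ k]) (auto simp: eq)
  have "f \<in> iso (subgroup_generated G (generate G {a})) (subgroup_generated H (generate H {b}))"
  proof (rule isoI)
    show "f \<in> hom (subgroup_generated G (generate G {a})) (subgroup_generated H (generate H {b}))"
      using assms sub by (auto simp: hom_def subgroup.carrier_subgroup_generated_subgroup
          G.generate_pow H.generate_pow f simp flip: G.int_pow_mult H.int_pow_mult)
    show "bij_betw f (carrier (subgroup_generated G (generate G {a}))) (carrier (subgroup_generated H (generate H {b})))"
      using assms sub by (auto simp: bij_betw_def inj_on_def subgroup.carrier_subgroup_generated_subgroup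
          G.generate_pow H.generate_pow f eq image_iff) (metis f)
  qed
  then show ?thesis
    by (rule is_isoI)
qed

text \<open>The second factor is realised inside \<open>G\<close> and keeps its type, so an
  induction on the order can continue with it.\<close>

lemma (in comm_group) split_off_cyclic:
  assumes fin: "finite (carrier G)" and a: "a \<in> carrier G"
    and exp: "\<And>x. x \<in> carrier G \<Longrightarrow> ord x dvd ord a"
  obtains B where "subgroup B G"
    "subgroup_generated G (generate G {a}) \<times>\<times> subgroup_generated G B \<cong> G"
proof -
  obtain B where B: "subgroup B G" "generate G {a} \<inter> B \<subseteq> {\<one>}" "generate G {a} <#> B = carrier G"
    using cyclic_subgroup_complement[OF assms] by blast
  interpret group_disjoint_sum G "generate G {a}" B
    using B a generate_is_subgroup by (simp add: group_disjoint_sum_def is_group)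
  show ?thesis
    using that B iso_group_mul[OF comm_group_axioms] by (meson is_isoI)
qed

text \<open>The counts determine the exponent, so both groups split off cyclic factors of the same
  order. Counts are multiplicative and nonzero, so those of the complements agree too, and induction
  on the order applies.\<close>

theorem comm_group_iso_if_card_torsion_eq:
  fixes G :: "('g, 'a) monoid_scheme" and H :: "('h, 'b) monoid_scheme"
  assumes "comm_group G" "comm_group H" "finite (carrier G)" "finite (carrier H)"
    and "\<And>n. card (torsion G n) = card (torsion H n)"
  shows "G \<cong> H"
  using assms
proof (induction "card (carrier G)" arbitrary: G H rule: less_induct)
  case less
  interpret G: comm_group G by fact
  interpret H: comm_group H by fact
  note fin = less.prems(3,4) and tors = less.prems(5)
  obtain a where a: "a \<in> carrier G" "\<And>x. x \<in> carrier G \<Longrightarrow> G.ord x dvd G.ord a"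
    using G.exists_ord_eq_exponent[OF fin(1)] by blast
  obtain b where b: "b \<in> carrier H" "\<And>x. x \<in> carrier H \<Longrightarrow> H.ord x dvd H.ord b"
    using H.exists_ord_eq_exponent[OF fin(2)] by blast
  have card: "card (carrier G) = card (carrier H)"
    using tors[of 0] by (simp add: torsion_def)
  \<comment> \<open>\<open>G.ord a\<close> is the exponent of \<open>G\<close>. Equal counts make it
    an exponent of \<open>H\<close> as well, and the symmetric argument gives equality of the two
    exponents.\<close>
  have "torsion G (G.ord a) = carrier G"
    using a by (auto simp: torsion_def G.pow_eq_id)
  then have "torsion H (G.ord a) = carrier H"
    using tors[of "G.ord a"] card fin by (intro card_subset_eq) (auto simp: torsion_def)
  then have "b \<in> torsion H (G.ord a)"
    using b by simp
  then have "H.ord b dvd G.ord a"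
    using b by (simp add: torsion_def H.pow_eq_id)
  have "torsion H (H.ord b) = carrier H"
    using b by (auto simp: torsion_def H.pow_eq_id)
  then have "torsion G (H.ord b) = carrier G"
    using tors[of "H.ord b"] card fin by (intro card_subset_eq) (auto simp: torsion_def)
  then have "a \<in> torsion G (H.ord b)"
    using a by simp
  then have "G.ord a dvd H.ord b"
    using a by (simp add: torsion_def G.pow_eq_id)
  with \<open>H.ord b dvd G.ord a\<close> have ord: "G.ord a = H.ord b"
    by (simp add: dvd_antisym)
  show ?case
  \<comment> \<open>With \<open>a\<close> trivial, splitting off its cyclic subgroup would not lower
    the order, but then both groups are trivial.\<close>
  proof (cases "a = \<one>\<^bsub>G\<^esub>")
    case True
    then have "carrier G = {\<one>\<^bsub>G\<^esub>}"
      using a G.ord_eq_1 by fastforce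
    moreover from this have "carrier H = {\<one>\<^bsub>H\<^esub>}"
      using card H.one_closed by (metis card_1_singletonE is_singletonI is_singleton_altdef singletonD)
    ultimately show ?thesis
      by (intro is_isoI[of "\<lambda>_. \<one>\<^bsub>H\<^esub>"] isoI) (auto simp: hom_def bij_betw_def)
  next
    case False
    let ?A = "subgroup_generated G (generate G {a})" and ?B = "subgroup_generated H (generate H {b})"
    obtain C where C: "subgroup C G" "?A \<times>\<times> subgroup_generated G C \<cong> G"
      using G.split_off_cyclic[OF fin(1) a] by blast
    obtain D where D: "subgroup D H" "?B \<times>\<times> subgroup_generated H D \<cong> H"
      using H.split_off_cyclic[OF fin(2) b] by blast
    let ?C = "subgroup_generated G C" and ?D = "subgroup_generated H D"
    have AB: "?A \<cong> ?B"
      by (intro cyclic_subgroups_iso G.is_group H.is_group a b ord)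
    have finC: "finite (carrier ?C)" and finD: "finite (carrier ?D)" and finA: "finite (carrier ?A)"
      using fin by (meson G.carrier_subgroup_generated_subset H.carrier_subgroup_generated_subset finite_subset)+
    have "?C \<cong> ?D"
    proof (rule less.hyps)
      have "card {\<one>\<^bsub>G\<^esub>, a} \<le> card (carrier ?A)"
        using finA a generate.incl[of a "{a}" G] generate.one[of G "{a}"]
        by (intro card_mono) (auto simp: carrier_subgroup_generated intro: generate.incl)
      then have "1 < card (carrier ?A)"
        using False by simp
      moreover have "0 < card (carrier ?C)"
        using finC group.is_monoid[OF G.group_subgroup_generated, THEN monoid.one_closed, of C]
        by (auto simp: card_gt_0_iff)
      ultimately show "card (carrier ?C) < card (carrier G)"
        using iso_same_card[OF C(2)] n_less_m_mult_n[of "card (carrier ?C)" "card (carrier ?A)"]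
        by (simp add: card_cartesian_product)
      fix n
      have "card (torsion ?A n) * card (torsion ?C n) = card (torsion (?A \<times>\<times> ?C) n)"
        by (simp add: torsion_DirProd card_cartesian_product)
      also have "\<dots> = card (torsion (?B \<times>\<times> ?D) n)"
        using card_torsion_iso[OF _ _ C(2), of n] card_torsion_iso[OF _ _ D(2), of n] tors[of n]
        by (simp add: DirProd_group)
      also have "\<dots> = card (torsion ?B n) * card (torsion ?D n)"
        by (simp add: torsion_DirProd card_cartesian_product)
      also have "card (torsion ?B n) = card (torsion ?A n)"
        using card_torsion_iso[OF _ _ AB] by simp
      moreover have "card (torsion ?A n) \<noteq> 0"
        using finA group.torsion_nonempty[OF G.group_subgroup_generated, of "generate G {a}" n]
        by (auto simp: torsion_def)
      ultimately show "card (torsion ?C n) = card (torsion ?D n)"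
        by simp
    qed (use finC finD G.abelian_subgroup_generated H.abelian_subgroup_generated less.prems in auto)
    then have "?A \<times>\<times> ?C \<cong> ?B \<times>\<times> ?D"
      using AB G.group_subgroup_generated group.DirProd_iso_trans by blast
    then show ?thesis
      using C(2) D(2) by (meson DirProd_group G.group_subgroup_generated group.iso_sym iso_trans)
  qed
qed

section \<open>Groups presented by power quandles\<close>

lemma gr_eq_imp_words:
  assumes "gr_eq P x y" "power_quandle P"
  shows "x \<in> words (pq_carrier P) \<and> y \<in> words (pq_carrier P)"
  using assms(1)
  by induction (use assms(2) in \<open>auto simp: words_def power_quandle_def pw_def\<close>)

definition gr_class :: "'p pquandle \<Rightarrow> ('p \<times> bool) list \<Rightarrow> ('p \<times> bool) list set" where
  "gr_class P w = gr_rel P `` {w}"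

lemma gr_class_eq_iff:
  assumes "u \<in> words (pq_carrier P)"
  shows "gr_class P u = gr_class P v \<longleftrightarrow> gr_eq P u v"
proof
  assume "gr_class P u = gr_class P v"
  then show "gr_eq P u v"
    using gr_refl[OF assms] by (auto simp: gr_class_def gr_rel_def set_eq_iff intro: gr_sym)
next
  assume "gr_eq P u v"
  then show "gr_class P u = gr_class P v"
    by (auto simp: gr_class_def gr_rel_def intro: gr_sym gr_trans)
qed

text \<open>\<open>Gr\<close> multiplies classes through representatives chosen by
  \<open>SOME\<close>; since \<open>gr_eq\<close> is a congruence, the choice does not
  matter.\<close>

lemma gr_class_append:
  assumes P: "power_quandle P" and uv: "u \<in> words (pq_carrier P)" "v \<in> words (pq_carrier P)"
  shows "gr_class P u \<otimes>\<^bsub>Gr P\<^esub> gr_class P v = gr_class P (u @ v)"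
proof -
  let ?u = "SOME x. x \<in> gr_class P u" and ?v = "SOME x. x \<in> gr_class P v"
  have "?u \<in> gr_class P u" "?v \<in> gr_class P v"
    using gr_refl[OF uv(1)] gr_refl[OF uv(2)] by (auto intro!: someI simp: gr_class_def gr_rel_def)
  then have e: "gr_eq P u ?u" "gr_eq P v ?v"
    by (auto simp: gr_class_def gr_rel_def)
  then have "?v \<in> words (pq_carrier P)"
    using gr_eq_imp_words P by blast
  then have "gr_eq P (u @ v) (?u @ ?v)"
    using gr_cong[OF e(2) uv(1), of "[]"] gr_cong[OF e(1), of "[]" ?v] by (auto simp: words_def intro: gr_trans)
  moreover have "u @ v \<in> words (pq_carrier P)"
    using uv by (auto simp: words_def)
  ultimately have "gr_class P (u @ v) = gr_class P (?u @ ?v)"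
    by (simp add: gr_class_eq_iff)
  then show ?thesis
    by (simp add: Gr_def gr_class_def)
qed

section \<open>Evaluation of words and the universal property of \<open>Gr P\<close>\<close>

fun eval_word :: "('h, 'b) monoid_scheme \<Rightarrow> ('p \<Rightarrow> 'h) \<Rightarrow> ('p \<times> bool) list \<Rightarrow> 'h" where
  "eval_word H t [] = \<one>\<^bsub>H\<^esub>"
| "eval_word H t ((a, s) # w) = (if s then t a else inv\<^bsub>H\<^esub> t a) \<otimes>\<^bsub>H\<^esub> eval_word H t w"

context group
begin

lemma eval_word_closed:
  assumes "t \<in> S \<rightarrow> carrier G" "w \<in> words S"
  shows "eval_word G t w \<in> carrier G"
  using assms(2)
proof (induction w)
  case (Cons l w)
  then show ?case
    using assms(1) by (cases l) (auto simp: words_def)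
qed auto

lemma eval_word_append:
  assumes "t \<in> S \<rightarrow> carrier G" "u \<in> words S" "v \<in> words S"
  shows "eval_word G t (u @ v) = eval_word G t u \<otimes> eval_word G t v"
  using assms(2)
proof (induction u)
  case Nil
  then show ?case
    using eval_word_closed[OF assms(1,3)] by simp
next
  case (Cons l u)
  moreover obtain a s where l: "l = (a, s)"
    by (cases l)
  ultimately have "u \<in> words S" "t a \<in> carrier G"
    using assms(1) by (auto simp: words_def)
  then show ?case
    using Cons eval_word_closed[OF assms(1)] assms(3) by (auto simp: l m_assoc)
qed

lemma eval_word_replicate:
  assumes "t a \<in> carrier G"
  shows "eval_word G t (replicate n (a, s)) = (if s then t a else inv t a) [^] n"
  using assms by (induction n) (auto simp flip: nat_pow_Suc2)

lemma eval_word_pw: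
  assumes "t a \<in> carrier G"
  shows "eval_word G t (pw a n) = t a [^] n"
proof (cases "0 \<le> n")
  case True
  then show ?thesis
    using eval_word_replicate[of t a "nat n" True] assms by (simp add: pw_def)
next
  case False
  then show ?thesis
    using eval_word_replicate[of t a "nat (- n)" False] assms int_pow_neg[of "t a" "- n"]
    by (simp add: pw_def int_pow_inv)
qed

text \<open>Well-definedness in the universal property of \<open>Gr P\<close>: each defining
  relation is matched by a hypothesis on \<open>t\<close>, and congruence by multiplicativity of
  evaluation.\<close>

lemma eval_word_gr_eq:
  assumes P: "power_quandle P" and t: "t \<in> pq_carrier P \<rightarrow> carrier G"
    and conj: "\<And>a b. \<lbrakk>a \<in> pq_carrier P; b \<in> pq_carrier P\<rbrakk> \<Longrightarrow> t (pq_op P a b) = t a \<otimes> t b \<otimes> inv t a"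
    and pow: "\<And>a n. a \<in> pq_carrier P \<Longrightarrow> t (pq_pi P n a) = t a [^] n"
    and unit: "t (pq_e P) = \<one>"
    and "gr_eq P u v"
  shows "eval_word G t u = eval_word G t v"
  using assms(6)
proof induction
  case (gr_cong x y u v)
  then have "x \<in> words (pq_carrier P)" "y \<in> words (pq_carrier P)"
    using gr_eq_imp_words P by blast+
  moreover from this have "x @ v \<in> words (pq_carrier P)" "y @ v \<in> words (pq_carrier P)"
    using gr_cong by (auto simp: words_def)
  ultimately show ?case
    using gr_cong by (simp add: eval_word_append[OF t])
next
  case (gr_cancel a s)
  then have "t a \<in> carrier G"
    using t by auto
  then show ?case
    by simp
next
  case (gr_conj a b)
  then have "t a \<in> carrier G" "t b \<in> carrier G"
    using t by auto
  then show ?case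
    using conj[OF gr_conj] by (simp add: m_assoc)
next
  case (gr_pow a n)
  then have "t a \<in> carrier G"
    using t by auto
  then show ?case
    using pow[OF gr_pow] by (simp add: eval_word_pw)
qed (use unit in auto)

end

section \<open>Power quandle morphisms between groups and the subgroups generated by their
  graphs\<close>

text \<open>A morphism from \<open>Pq G\<close> to \<open>Pq H\<close>, written in the group
  operations.\<close>

definition pq_hom :: "('g, 'a) monoid_scheme \<Rightarrow> ('h, 'b) monoid_scheme \<Rightarrow> ('g \<Rightarrow> 'h) \<Rightarrow> bool" where
  "pq_hom G H f \<longleftrightarrow> f \<in> carrier G \<rightarrow> carrier H \<and>
    (\<forall>a\<in>carrier G. \<forall>b\<in>carrier G. f (a \<otimes>\<^bsub>G\<^esub> b \<otimes>\<^bsub>G\<^esub> inv\<^bsub>G\<^esub> a) = f a \<otimes>\<^bsub>H\<^esub> f b \<otimes>\<^bsub>H\<^esub> inv\<^bsub>H\<^esub> f a) \<and>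
    (\<forall>a\<in>carrier G. \<forall>n::int. f (a [^]\<^bsub>G\<^esub> n) = f a [^]\<^bsub>H\<^esub> n) \<and> f \<one>\<^bsub>G\<^esub> = \<one>\<^bsub>H\<^esub>"

text \<open>A \<open>pq_hom\<close> need not be multiplicative, so its graph need not be a subgroup
  and generation is required.\<close>

definition graph_subgroup :: "('g, 'a) monoid_scheme \<Rightarrow> ('h, 'b) monoid_scheme \<Rightarrow> ('g \<Rightarrow> 'h) \<Rightarrow> ('g \<times> 'h) set" where
  "graph_subgroup G H f = generate (G \<times>\<times> H) ((\<lambda>a. (a, f a)) ` carrier G)"

text \<open>Restricted to the generators of \<open>Gr P\<close>, \<open>f\<close> respects the
  defining relations and so extends to a homomorphism. Away from the generators \<alpha> may differ
  from \<open>f\<close>, but \<open>(g, \<alpha> g)\<close> is a product of graph points of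
  generators and their inverses.\<close>

lemma pq_hom_lift:
  assumes "group G" "group H" and P: "power_quandle P" and iso: "G \<cong> Gr P" and f: "pq_hom G H f"
  obtains \<alpha> where "\<alpha> \<in> hom G H" "\<And>g. g \<in> carrier G \<Longrightarrow> (g, \<alpha> g) \<in> graph_subgroup G H f"
proof -
  interpret G: group G by fact
  interpret H: group H by fact
  interpret GH: group "G \<times>\<times> H"
    by (intro DirProd_group assms)
  let ?W = "words (pq_carrier P)"
  let ?E = "graph_subgroup G H f"
  have appW: "u @ v \<in> ?W" if "u \<in> ?W" "v \<in> ?W" for u v
    using that by (auto simp: words_def)
  have nilW: "[] \<in> ?W"
    by (simp add: words_def)
  obtain \<psi> where \<psi>: "\<psi> \<in> iso G (Gr P)"
    using iso by (auto simp: is_iso_def)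
  have carr: "carrier (Gr P) = gr_class P ` ?W"
    by (auto simp: Gr_def gr_class_def quotient_def)
  have bij: "bij_betw \<psi> (carrier G) (gr_class P ` ?W)"
    using \<psi> by (simp add: iso_def carr)
  \<comment> \<open>\<open>c\<close> is the value in \<open>G\<close> of a word over \<open>P\<close>, under the given isomorphism\<close>
  define c where "c w = inv_into (carrier G) \<psi> (gr_class P w)" for w
  have c: "c w \<in> carrier G" "\<psi> (c w) = gr_class P w" if "w \<in> ?W" for w
    using bij that by (auto simp: c_def bij_betw_def inv_into_into f_inv_into_f)
  have c_unique: "c w = g" if "g \<in> carrier G" "\<psi> g = gr_class P w" for g w
    using bij that unfolding c_def by (metis bij_betw_inv_into_left)
  have c_surj: "\<exists>w\<in>?W. c w = g" if "g \<in> carrier G" for g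
    using bij that c_unique by (metis bij_betw_apply imageE)
  have c_append: "c (u @ v) = c u \<otimes>\<^bsub>G\<^esub> c v" if "u \<in> ?W" "v \<in> ?W" for u v
  proof (rule c_unique)
    have "\<psi> (c u \<otimes>\<^bsub>G\<^esub> c v) = \<psi> (c u) \<otimes>\<^bsub>Gr P\<^esub> \<psi> (c v)"
      using \<psi> c that by (auto simp: iso_def hom_def)
    then show "\<psi> (c u \<otimes>\<^bsub>G\<^esub> c v) = gr_class P (u @ v)"
      using c that gr_class_append[OF P] by simp
  qed (use c that in auto)
  have c_eq: "c u = c v \<longleftrightarrow> gr_eq P u v" if "u \<in> ?W" "v \<in> ?W" for u v
    using c that gr_class_eq_iff[OF that(1), of v] by (metis c_def)
  have c_nil: "c [] = \<one>\<^bsub>G\<^esub>"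
    using c_append[OF nilW nilW] c(1)[OF nilW] by simp
  \<comment> \<open>The element of \<open>G\<close> that corresponds to the generator \<sigma>(p) of
    \<open>Gr P\<close>.\<close>
  define s where "s p = c [(p, True)]" for p
  have s: "s p \<in> carrier G" if "p \<in> pq_carrier P" for p
    using c that by (simp add: s_def words_def)
  have c_neg: "c [(p, False)] = inv\<^bsub>G\<^esub> s p" if "p \<in> pq_carrier P" for p
  proof -
    have W: "[(p, False)] \<in> ?W" "[(p, True)] \<in> ?W" "[(p, False), (p, True)] \<in> ?W"
      using that by (auto simp: words_def)
    have "c [(p, False)] \<otimes>\<^bsub>G\<^esub> s p = c [(p, False), (p, True)]"
      using c_append[OF W(1,2)] by (simp add: s_def)
    also have "\<dots> = \<one>\<^bsub>G\<^esub>"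
      using c_eq[OF W(3) nilW] gr_cancel[OF that, of False] c_nil by simp
    finally show ?thesis
      using s[OF that] c(1)[OF W(1)] by (simp add: G.inv_equality)
  qed
  have c_eval: "c w = eval_word G s w" if "w \<in> ?W" for w
    using that
  proof (induction w)
    case (Cons l w)
    obtain p b where l: "l = (p, b)"
      by (cases l)
    have W: "[l] \<in> ?W" "w \<in> ?W" "p \<in> pq_carrier P"
      using Cons.prems by (auto simp: words_def l)
    have "c (l # w) = c [l] \<otimes>\<^bsub>G\<^esub> c w"
      using c_append[OF W(1,2)] by simp
    then show ?case
      using Cons.IH W c_neg by (auto simp: l s_def)
  qed (simp add: c_nil)
  have s_conj: "s (pq_op P a b) = s a \<otimes>\<^bsub>G\<^esub> s b \<otimes>\<^bsub>G\<^esub> inv\<^bsub>G\<^esub> s a"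
    if "a \<in> pq_carrier P" "b \<in> pq_carrier P" for a b
  proof -
    have "[(pq_op P a b, True)] \<in> ?W" "[(a, True), (b, True), (a, False)] \<in> ?W"
      using gr_eq_imp_words[OF gr_conj[OF that] P] by auto
    then have "s (pq_op P a b) = eval_word G s [(a, True), (b, True), (a, False)]"
      using c_eq gr_conj[OF that] c_eval unfolding s_def by metis
    then show ?thesis
      using s that by (simp add: G.m_assoc)
  qed
  have s_pow: "s (pq_pi P n a) = s a [^]\<^bsub>G\<^esub> n" if "a \<in> pq_carrier P" for a n
  proof -
    have "[(pq_pi P n a, True)] \<in> ?W" "pw a n \<in> ?W"
      using gr_eq_imp_words[OF gr_pow[OF that] P] by auto
    then have "s (pq_pi P n a) = eval_word G s (pw a n)"
      using c_eq gr_pow[OF that] c_eval unfolding s_def by metis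
    then show ?thesis
      using s that by (simp add: G.eval_word_pw)
  qed
  have s_unit: "s (pq_e P) = \<one>\<^bsub>G\<^esub>"
  proof -
    have "[(pq_e P, True)] \<in> ?W"
      using gr_eq_imp_words[OF gr_unit P] by auto
    then show ?thesis
      using c_eq[OF _ nilW] gr_unit c_nil by (simp add: s_def)
  qed
  let ?t = "\<lambda>p. f (s p)"
  have t: "?t \<in> pq_carrier P \<rightarrow> carrier H"
    using f s by (auto simp: pq_hom_def)
  have t_eq: "eval_word H ?t u = eval_word H ?t v" if "gr_eq P u v" for u v
    using P t _ _ _ that
  proof (rule H.eval_word_gr_eq)
    show "?t (pq_op P a b) = ?t a \<otimes>\<^bsub>H\<^esub> ?t b \<otimes>\<^bsub>H\<^esub> inv\<^bsub>H\<^esub> ?t a"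
      if "a \<in> pq_carrier P" "b \<in> pq_carrier P" for a b
      using f s that by (simp add: pq_hom_def s_conj)
    show "?t (pq_pi P n a) = ?t a [^]\<^bsub>H\<^esub> n" if "a \<in> pq_carrier P" for a n
      using f s that by (simp add: pq_hom_def s_pow)
    show "?t (pq_e P) = \<one>\<^bsub>H\<^esub>"
      using f by (simp add: pq_hom_def s_unit)
  qed
  have E: "subgroup ?E (G \<times>\<times> H)"
    unfolding graph_subgroup_def using f by (intro GH.generate_is_subgroup) (auto simp: pq_hom_def)
  \<comment> \<open>The pair is the value of \<open>w\<close> in the product when each letter
    \<open>p\<close> goes to the graph point \<open>(s p, f (s p))\<close>.\<close>
  have mem_E: "(c w, eval_word H ?t w) \<in> ?E" if "w \<in> ?W" for w
    using that
  proof (induction w)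
    case Nil
    then show ?case
      using subgroup.one_closed[OF E] by (simp add: c_nil)
  next
    case (Cons l w)
    obtain p b where l: "l = (p, b)"
      by (cases l)
    have W: "w \<in> ?W" "p \<in> pq_carrier P"
      using Cons.prems by (auto simp: words_def l)
    have gen: "(s p, ?t p) \<in> ?E"
      unfolding graph_subgroup_def using s W by (auto intro: generate.incl)
    have "(inv\<^bsub>G\<^esub> s p, inv\<^bsub>H\<^esub> ?t p) \<in> ?E"
      using subgroup.m_inv_closed[OF E gen] inv_DirProd[OF assms(1,2) s[OF W(2)], of "?t p"]
        funcset_mem[OF t W(2)] by simp
    then have "(if b then s p else inv\<^bsub>G\<^esub> s p, if b then ?t p else inv\<^bsub>H\<^esub> ?t p) \<in> ?E"
      using gen by auto
    from subgroup.m_closed[OF E this Cons.IH[OF W(1)]] show ?case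
      using Cons.prems W by (simp add: c_eval l)
  qed
  \<comment> \<open>Any word representing \<open>g\<close> would do: two of them are related by
    \<open>gr_eq\<close>, hence have the same value in \<open>H\<close> by
    \<open>t_eq\<close>.\<close>
  define wd where "wd g = (SOME w. w \<in> ?W \<and> c w = g)" for g
  have wd: "wd g \<in> ?W \<and> c (wd g) = g" if "g \<in> carrier G" for g
    unfolding wd_def by (rule someI_ex) (use c_surj[OF that] in blast)
  let ?\<alpha> = "\<lambda>g. eval_word H ?t (wd g)"
  have "?\<alpha> \<in> hom G H"
  proof (rule homI)
    show "?\<alpha> g \<in> carrier H" if "g \<in> carrier G" for g
      using H.eval_word_closed[OF t] wd[OF that] by blast
    fix x y assume xy: "x \<in> carrier G" "y \<in> carrier G"
    then have "gr_eq P (wd (x \<otimes>\<^bsub>G\<^esub> y)) (wd x @ wd y)"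
      using wd appW c_append by (subst c_eq[symmetric]) auto
    then show "?\<alpha> (x \<otimes>\<^bsub>G\<^esub> y) = ?\<alpha> x \<otimes>\<^bsub>H\<^esub> ?\<alpha> y"
      using t_eq H.eval_word_append[OF t] wd xy by simp
  qed
  moreover have "(g, ?\<alpha> g) \<in> ?E" if "g \<in> carrier G" for g
    using mem_E wd[OF that] by metis
  ultimately show ?thesis
    using that by blast
qed

lemma graph_subgroup_is_subgroup:
  assumes "group G" "group H" "pq_hom G H f"
  shows "subgroup (graph_subgroup G H f) (G \<times>\<times> H)"
  unfolding graph_subgroup_def
  using assms by (intro group.generate_is_subgroup DirProd_group) (auto simp: pq_hom_def)

text \<open>For graph points this is preservation of conjugation by \<open>f\<close>, and it passes
  to inverses and products by composing conjugations.\<close>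

lemma graph_subgroup_conj:
  assumes "group G" "group H" and f: "pq_hom G H f" "bij_betw f (carrier G) (carrier H)"
    and z: "z \<in> graph_subgroup G H f" and b: "b \<in> carrier G"
  shows "f (fst z \<otimes>\<^bsub>G\<^esub> b \<otimes>\<^bsub>G\<^esub> inv\<^bsub>G\<^esub> fst z) = snd z \<otimes>\<^bsub>H\<^esub> f b \<otimes>\<^bsub>H\<^esub> inv\<^bsub>H\<^esub> snd z"
proof -
  interpret G: group G by fact
  interpret H: group H by fact
  interpret GH: group "G \<times>\<times> H"
    by (intro DirProd_group assms)
  have fc: "f x \<in> carrier H" if "x \<in> carrier G" for x
    using f that by (auto simp: pq_hom_def)
  have f_conj: "f (x \<otimes>\<^bsub>G\<^esub> b \<otimes>\<^bsub>G\<^esub> inv\<^bsub>G\<^esub> x) = f x \<otimes>\<^bsub>H\<^esub> f b \<otimes>\<^bsub>H\<^esub> inv\<^bsub>H\<^esub> f x"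
    if "x \<in> carrier G" "b \<in> carrier G" for x b
    using f that by (auto simp: pq_hom_def)
  have sub: "(\<lambda>a. (a, f a)) ` carrier G \<subseteq> carrier (G \<times>\<times> H)"
    using fc by auto
  show ?thesis
    using z b unfolding graph_subgroup_def
  proof (induction arbitrary: b rule: generate.induct)
    case one
    then show ?case
      using fc by simp
  next
    case (incl h)
    then show ?case
      using f_conj by auto
  next
    case (inv h)
    then obtain a where a: "h = (a, f a)" "a \<in> carrier G"
      by auto
    \<comment> \<open>Preservation of inverses is the case of exponent -1 of preservation of
      powers.\<close>
    have "f (a [^]\<^bsub>G\<^esub> (-1 :: int)) = f a [^]\<^bsub>H\<^esub> (-1 :: int)"
      using f(1) a unfolding pq_hom_def by blast
    then have "f (inv\<^bsub>G\<^esub> a) = inv\<^bsub>H\<^esub> f a"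
      using a fc by (simp add: G.int_pow_neg H.int_pow_neg)
    then show ?case
      using f_conj[of "inv\<^bsub>G\<^esub> a" b] a inv.prems inv_DirProd[OF assms(1,2) a(2), of "f a"] fc by simp
  next
    case (eng h1 h2)
    have h: "h1 \<in> carrier (G \<times>\<times> H)" "h2 \<in> carrier (G \<times>\<times> H)"
      using eng GH.generate_in_carrier[OF sub] by auto
    then have c: "fst h1 \<in> carrier G" "fst h2 \<in> carrier G" "snd h1 \<in> carrier H" "snd h2 \<in> carrier H"
      by auto
    have "f (fst h1 \<otimes>\<^bsub>G\<^esub> (fst h2 \<otimes>\<^bsub>G\<^esub> b \<otimes>\<^bsub>G\<^esub> inv\<^bsub>G\<^esub> fst h2) \<otimes>\<^bsub>G\<^esub> inv\<^bsub>G\<^esub> fst h1)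
      = snd h1 \<otimes>\<^bsub>H\<^esub> (snd h2 \<otimes>\<^bsub>H\<^esub> f b \<otimes>\<^bsub>H\<^esub> inv\<^bsub>H\<^esub> snd h2) \<otimes>\<^bsub>H\<^esub> inv\<^bsub>H\<^esub> snd h1"
      using eng c by simp
    then show ?case
      using c eng.prems fc by (simp add: mult_DirProd' G.inv_mult_group H.inv_mult_group G.m_assoc H.m_assoc)
  qed
qed

text \<open>The map \<open>g \<mapsto> (g, \<alpha> g)\<close> is a section of the first projection
  of \<open>E\<close>. Since the kernel of that projection is central, the resulting splitting is a
  direct product.\<close>

lemma DirProd_central_fibre_iso:
  assumes "group G" "group H" and E: "subgroup E (G \<times>\<times> H)"
    and \<alpha>: "\<alpha> \<in> hom G H" "\<And>g. g \<in> carrier G \<Longrightarrow> (g, \<alpha> g) \<in> E"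
    and central: "\<And>k h. \<lbrakk>(\<one>\<^bsub>G\<^esub>, k) \<in> E; h \<in> carrier H\<rbrakk> \<Longrightarrow> k \<otimes>\<^bsub>H\<^esub> h = h \<otimes>\<^bsub>H\<^esub> k"
  shows "G \<times>\<times> H\<lparr>carrier := {k. (\<one>\<^bsub>G\<^esub>, k) \<in> E}\<rparr> \<cong> (G \<times>\<times> H)\<lparr>carrier := E\<rparr>"
proof -
  interpret G: group G by fact
  interpret H: group H by fact
  interpret \<alpha>: group_hom G H \<alpha>
    using \<alpha> by unfold_locales
  let ?K = "{k. (\<one>\<^bsub>G\<^esub>, k) \<in> E}"
  let ?F = "\<lambda>(g, k). (g, \<alpha> g \<otimes>\<^bsub>H\<^esub> k)"
  have EC: "g \<in> carrier G" "h \<in> carrier H" if "(g, h) \<in> E" for g h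
    using subgroup.mem_carrier[OF E that] by auto
  have mem: "(g, \<alpha> g \<otimes>\<^bsub>H\<^esub> k) \<in> E" if "g \<in> carrier G" "(\<one>\<^bsub>G\<^esub>, k) \<in> E" for g k
    using subgroup.m_closed[OF E \<alpha>(2)[OF that(1)] that(2)] that by simp
  have surj: "(g, h) \<in> ?F ` (carrier G \<times> ?K)" if gh: "(g, h) \<in> E" for g h
  proof -
    note c = EC[OF gh]
    have "(inv\<^bsub>G\<^esub> g, inv\<^bsub>H\<^esub> \<alpha> g) \<in> E"
      using subgroup.m_inv_closed[OF E \<alpha>(2)[OF c(1)]] inv_DirProd[OF assms(1,2) c(1), of "\<alpha> g"] c by simp
    from subgroup.m_closed[OF E this gh] have "inv\<^bsub>H\<^esub> \<alpha> g \<otimes>\<^bsub>H\<^esub> h \<in> ?K"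
      using c by simp
    moreover have "(g, h) = ?F (g, inv\<^bsub>H\<^esub> \<alpha> g \<otimes>\<^bsub>H\<^esub> h)"
      using c by (simp flip: H.m_assoc)
    ultimately show ?thesis
      using c by blast
  qed
  have "?F \<in> iso (G \<times>\<times> H\<lparr>carrier := ?K\<rparr>) ((G \<times>\<times> H)\<lparr>carrier := E\<rparr>)"
  proof (rule isoI)
    \<comment> \<open>Multiplicativity of \<open>?F\<close> amounts to moving the central
      \<open>k\<close> past \<open>\<alpha> g'\<close>.\<close>
    have "\<alpha> g \<otimes>\<^bsub>H\<^esub> \<alpha> g' \<otimes>\<^bsub>H\<^esub> (k \<otimes>\<^bsub>H\<^esub> k') = \<alpha> g \<otimes>\<^bsub>H\<^esub> k \<otimes>\<^bsub>H\<^esub> (\<alpha> g' \<otimes>\<^bsub>H\<^esub> k')"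
      if "g \<in> carrier G" "g' \<in> carrier G" "(\<one>\<^bsub>G\<^esub>, k) \<in> E" "(\<one>\<^bsub>G\<^esub>, k') \<in> E" for g g' k k'
    proof -
      have "k \<otimes>\<^bsub>H\<^esub> (\<alpha> g' \<otimes>\<^bsub>H\<^esub> k') = \<alpha> g' \<otimes>\<^bsub>H\<^esub> (k \<otimes>\<^bsub>H\<^esub> k')"
        using central[OF that(3), of "\<alpha> g'"] that EC(2)[OF that(3)] EC(2)[OF that(4)]
        by (simp flip: H.m_assoc)
      then show ?thesis
        using that EC(2)[OF that(3)] EC(2)[OF that(4)] by (simp add: H.m_assoc)
    qed
    then show "?F \<in> hom (G \<times>\<times> H\<lparr>carrier := ?K\<rparr>) ((G \<times>\<times> H)\<lparr>carrier := E\<rparr>)"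
      using mem by (auto simp: hom_def)
    have "inj_on ?F (carrier G \<times> ?K)"
      using EC by (auto simp: inj_on_def)
    moreover have "?F ` (carrier G \<times> ?K) = E"
      using mem surj by auto
    ultimately show "bij_betw ?F (carrier (G \<times>\<times> H\<lparr>carrier := ?K\<rparr>)) (carrier ((G \<times>\<times> H)\<lparr>carrier := E\<rparr>))"
      by (simp add: bij_betw_def)
  qed
  then show ?thesis
    by (rule is_isoI)
qed

lemma pq_generated_split:
  assumes "group G" "group H" "power_quandle P" "G \<cong> Gr P"
    and f: "pq_hom G H f" "bij_betw f (carrier G) (carrier H)"
  obtains K where "subgroup K H" "comm_group (H\<lparr>carrier := K\<rparr>)"
    "G \<times>\<times> H\<lparr>carrier := K\<rparr> \<cong> (G \<times>\<times> H)\<lparr>carrier := graph_subgroup G H f\<rparr>"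
proof
  interpret G: group G by fact
  interpret H: group H by fact
  let ?E = "graph_subgroup G H f"
  let ?K = "{k. (\<one>\<^bsub>G\<^esub>, k) \<in> ?E}"
  have E: "subgroup ?E (G \<times>\<times> H)"
    by (intro graph_subgroup_is_subgroup assms)
  have KC: "k \<in> carrier H" if "(\<one>\<^bsub>G\<^esub>, k) \<in> ?E" for k
    using subgroup.mem_carrier[OF E that] by simp
  have central: "k \<otimes>\<^bsub>H\<^esub> h = h \<otimes>\<^bsub>H\<^esub> k" if k: "(\<one>\<^bsub>G\<^esub>, k) \<in> ?E" and h: "h \<in> carrier H" for k h
  proof -
    obtain b where b: "b \<in> carrier G" "h = f b"
      using f(2) h by (auto simp: bij_betw_def)
    \<comment> \<open>Conjugation by \<open>k\<close> corresponds under \<open>f\<close> to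
      conjugation by \<open>\<one>\<close> in \<open>G\<close>, and every \<open>h\<close> is a
      value of \<open>f\<close>.\<close>
    have "h = k \<otimes>\<^bsub>H\<^esub> h \<otimes>\<^bsub>H\<^esub> inv\<^bsub>H\<^esub> k"
      using graph_subgroup_conj[OF assms(1,2) f k b(1)] b by simp
    then show ?thesis
      using h KC[OF k] by (metis H.inv_solve_right H.m_closed)
  qed
  show K: "subgroup ?K H"
  proof (rule H.subgroupI)
    show "?K \<subseteq> carrier H" "?K \<noteq> {}"
      using KC subgroup.one_closed[OF E] by auto
    show "inv\<^bsub>H\<^esub> k \<in> ?K" if "k \<in> ?K" for k
      using subgroup.m_inv_closed[OF E, of "(\<one>\<^bsub>G\<^esub>, k)"] inv_DirProd[OF assms(1,2) G.one_closed, of k] KC that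
      by simp
    show "k \<otimes>\<^bsub>H\<^esub> l \<in> ?K" if "k \<in> ?K" "l \<in> ?K" for k l
      using subgroup.m_closed[OF E, of "(\<one>\<^bsub>G\<^esub>, k)" "(\<one>\<^bsub>G\<^esub>, l)"] that by simp
  qed
  show "comm_group (H\<lparr>carrier := ?K\<rparr>)"
    by (rule group.group_comm_groupI[OF H.subgroup_imp_group[OF K]]) (use central KC in auto)
  obtain \<alpha> where "\<alpha> \<in> hom G H" "\<And>g. g \<in> carrier G \<Longrightarrow> (g, \<alpha> g) \<in> ?E"
    using pq_hom_lift[OF assms(1-4) f(1)] by blast
  then show "G \<times>\<times> H\<lparr>carrier := ?K\<rparr> \<cong> (G \<times>\<times> H)\<lparr>carrier := ?E\<rparr>"
    using DirProd_central_fibre_iso[OF assms(1,2) E] central by blast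
qed

text \<open>Exchanging coordinates carries the graph of \<open>f\<close> onto the graph of its
  inverse \<open>g\<close>, and hence one generated subgroup onto the other.\<close>

lemma graph_subgroup_swap_iso:
  assumes "group G" "group H" and f: "pq_hom G H f"
    and g: "bij_betw f (carrier G) (carrier H)" "\<And>a. a \<in> carrier G \<Longrightarrow> g (f a) = a"
  shows "(G \<times>\<times> H)\<lparr>carrier := graph_subgroup G H f\<rparr> \<cong> (H \<times>\<times> G)\<lparr>carrier := graph_subgroup H G g\<rparr>"
proof -
  let ?s = "\<lambda>(x, y). (y, x)"
  have hom: "group_hom (G \<times>\<times> H) (H \<times>\<times> G) ?s"
    using assms(1,2) by (auto simp: group_hom_def group_hom_axioms_def hom_def intro: DirProd_group)
  have sub: "(\<lambda>a. (a, f a)) ` carrier G \<subseteq> carrier (G \<times>\<times> H)"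
    using f by (auto simp: pq_hom_def)
  have "?s ` (\<lambda>a. (a, f a)) ` carrier G = (\<lambda>b. (b, g b)) ` f ` carrier G"
    using g(2) by (simp add: image_image)
  also have "f ` carrier G = carrier H"
    using g(1) by (simp add: bij_betw_def)
  finally have "graph_subgroup H G g = ?s ` graph_subgroup G H f"
    unfolding graph_subgroup_def
    using group_hom.generate_img[OF hom sub] by simp
  then have "?s \<in> iso ((G \<times>\<times> H)\<lparr>carrier := graph_subgroup G H f\<rparr>) ((H \<times>\<times> G)\<lparr>carrier := graph_subgroup H G g\<rparr>)"
    by (intro isoI) (auto simp: hom_def bij_betw_def inj_on_def)
  then show ?thesis
    by (rule is_isoI)
qed

section \<open>Isomorphisms between \<open>Pq G\<close> and \<open>Pq H\<close>, and the final
  comparison\<close>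

lemma pq_iso_PqE:
  assumes "pq_iso (Pq G) (Pq H)"
  obtains f where "pq_hom G H f" "bij_betw f (carrier G) (carrier H)"
proof -
  from assms obtain f where f: "bij_betw f (carrier G) (carrier H)"
    "\<forall>a\<in>carrier G. \<forall>b\<in>carrier G. f (a \<otimes>\<^bsub>G\<^esub> b \<otimes>\<^bsub>G\<^esub> inv\<^bsub>G\<^esub> a) = f a \<otimes>\<^bsub>H\<^esub> f b \<otimes>\<^bsub>H\<^esub> inv\<^bsub>H\<^esub> f a"
    "\<forall>n::int. \<forall>a\<in>carrier G. f (a [^]\<^bsub>G\<^esub> n) = f a [^]\<^bsub>H\<^esub> n" "f \<one>\<^bsub>G\<^esub> = \<one>\<^bsub>H\<^esub>"
    unfolding pq_iso_def Pq_def pquandle.simps by (elim exE conjE)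
  have "pq_hom G H f"
    unfolding pq_hom_def using f bij_betw_imp_funcset[OF f(1)] by blast
  then show ?thesis
    using that f(1) by blast
qed

lemma pq_hom_inv_into:
  assumes "group G" "group H" and f: "pq_hom G H f" "bij_betw f (carrier G) (carrier H)"
  shows "pq_hom H G (inv_into (carrier G) f)"
proof -
  interpret G: group G by fact
  interpret H: group H by fact
  let ?g = "inv_into (carrier G) f"
  have left: "?g (f a) = a" if "a \<in> carrier G" for a
    using f(2) that by (simp add: bij_betw_inv_into_left)
  have sur: "\<exists>x\<in>carrier G. a = f x" if "a \<in> carrier H" for a
    using f(2) that by (auto simp: bij_betw_def)
  have "?g (a \<otimes>\<^bsub>H\<^esub> b \<otimes>\<^bsub>H\<^esub> inv\<^bsub>H\<^esub> a) = ?g a \<otimes>\<^bsub>G\<^esub> ?g b \<otimes>\<^bsub>G\<^esub> inv\<^bsub>G\<^esub> ?g a"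
    if ab: "a \<in> carrier H" "b \<in> carrier H" for a b
  proof -
    obtain x y where xy: "x \<in> carrier G" "a = f x" "y \<in> carrier G" "b = f y"
      using sur ab by blast
    then have "a \<otimes>\<^bsub>H\<^esub> b \<otimes>\<^bsub>H\<^esub> inv\<^bsub>H\<^esub> a = f (x \<otimes>\<^bsub>G\<^esub> y \<otimes>\<^bsub>G\<^esub> inv\<^bsub>G\<^esub> x)"
      using f(1) by (simp add: pq_hom_def)
    then show ?thesis
      using xy by (simp add: left)
  qed
  moreover have "?g (a [^]\<^bsub>H\<^esub> n) = ?g a [^]\<^bsub>G\<^esub> n" if a: "a \<in> carrier H" for a and n :: int
  proof -
    obtain x where x: "x \<in> carrier G" "a = f x"
      using sur a by blast
    then have "a [^]\<^bsub>H\<^esub> n = f (x [^]\<^bsub>G\<^esub> n)"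
      using f(1) by (simp add: pq_hom_def)
    then show ?thesis
      using x by (simp add: left)
  qed
  moreover have "?g \<one>\<^bsub>H\<^esub> = \<one>\<^bsub>G\<^esub>"
    using left[OF G.one_closed] f(1) by (simp add: pq_hom_def)
  moreover have "?g \<in> carrier H \<rightarrow> carrier G"
    using sur left by force
  ultimately show ?thesis
    by (simp add: pq_hom_def)
qed

lemma card_torsion_pq_hom:
  assumes "group G" "group H" and f: "pq_hom G H f" "bij_betw f (carrier G) (carrier H)"
  shows "card (torsion G n) = card (torsion H n)"
proof -
  interpret G: group G by fact
  have eq: "f x [^]\<^bsub>H\<^esub> n = \<one>\<^bsub>H\<^esub> \<longleftrightarrow> x [^]\<^bsub>G\<^esub> n = \<one>\<^bsub>G\<^esub>" if x: "x \<in> carrier G" for x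
  proof -
    have "f (x [^]\<^bsub>G\<^esub> int n) = f x [^]\<^bsub>H\<^esub> int n" "f \<one>\<^bsub>G\<^esub> = \<one>\<^bsub>H\<^esub>"
      using f(1) x unfolding pq_hom_def by auto
    then have "f (x [^]\<^bsub>G\<^esub> n) = f x [^]\<^bsub>H\<^esub> n" "f \<one>\<^bsub>G\<^esub> = \<one>\<^bsub>H\<^esub>"
      by (simp_all add: int_pow_int)
    then show ?thesis
      using f(2) x by (metis G.nat_pow_closed G.one_closed bij_betw_def inj_on_eq_iff)
  qed
  show ?thesis
    using card_torsion_bij[OF f(2) eq] by simp
qed

theorem mainTheorem14:
  fixes G :: "('g, 'a) monoid_scheme" and H :: "('h, 'b) monoid_scheme"
  assumes "group G" and "group H"
    and "finite (carrier G)" and "finite (carrier H)"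
    and "\<exists>P :: 'p pquandle. power_quandle P \<and> G \<cong> Gr P"
    and "\<exists>Q :: 'q pquandle. power_quandle Q \<and> H \<cong> Gr Q"
    and "pq_iso (Pq G) (Pq H)"
  shows "G \<cong> H"
proof -
  interpret G: group G by fact
  interpret H: group H by fact
  obtain P :: "'p pquandle" where P: "power_quandle P" "G \<cong> Gr P"
    using assms(5) by blast
  obtain Q :: "'q pquandle" where Q: "power_quandle Q" "H \<cong> Gr Q"
    using assms(6) by blast
  obtain f where f: "pq_hom G H f" "bij_betw f (carrier G) (carrier H)"
    using pq_iso_PqE[OF assms(7)] by blast
  let ?g = "inv_into (carrier G) f"
  have g: "pq_hom H G ?g" "bij_betw ?g (carrier H) (carrier G)"
    using pq_hom_inv_into[OF assms(1,2) f] bij_betw_inv_into[OF f(2)] by auto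
  obtain K where K: "subgroup K H" "comm_group (H\<lparr>carrier := K\<rparr>)"
    and splitG: "G \<times>\<times> H\<lparr>carrier := K\<rparr> \<cong> (G \<times>\<times> H)\<lparr>carrier := graph_subgroup G H f\<rparr>"
    using pq_generated_split[OF assms(1,2) P f] by blast
  obtain L where L: "subgroup L G" "comm_group (G\<lparr>carrier := L\<rparr>)"
    and splitH: "H \<times>\<times> G\<lparr>carrier := L\<rparr> \<cong> (H \<times>\<times> G)\<lparr>carrier := graph_subgroup H G ?g\<rparr>"
    using pq_generated_split[OF assms(2,1) Q g] by blast
  let ?K = "H\<lparr>carrier := K\<rparr>" and ?L = "G\<lparr>carrier := L\<rparr>"
  have groups: "group ?K" "group ?L" "group (G \<times>\<times> ?K)" "group (H \<times>\<times> ?L)"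
    using K L assms(1,2) by (auto intro: DirProd_group simp: comm_group_def)
  have fin: "finite (carrier ?K)" "finite (carrier ?L)"
    using subgroup.subset[OF K(1)] subgroup.subset[OF L(1)] assms(3,4) by (auto intro: finite_subset)
  have swap: "(G \<times>\<times> H)\<lparr>carrier := graph_subgroup G H f\<rparr> \<cong> (H \<times>\<times> G)\<lparr>carrier := graph_subgroup H G ?g\<rparr>"
    using f by (intro graph_subgroup_swap_iso assms(1,2)) (auto simp: bij_betw_inv_into_left)
  have GK_HL: "G \<times>\<times> ?K \<cong> H \<times>\<times> ?L"
    using iso_trans[OF iso_trans[OF splitG swap] group.iso_sym[OF groups(4) splitH]] .
  have "?L \<cong> ?K"
  proof (rule comm_group_iso_if_card_torsion_eq[OF L(2) K(2) fin(2,1)])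
    fix n
    \<comment> \<open>Counting torsion on both sides of \<open>GK_HL\<close> leaves the common
      nonzero factor \<open>card (torsion G n) = card (torsion H n)\<close> to be cancelled.\<close>
    have "card (torsion G n) * card (torsion ?K n) = card (torsion H n) * card (torsion ?L n)"
      using card_torsion_iso[OF groups(3,4) GK_HL, of n] by (simp add: torsion_DirProd card_cartesian_product)
    moreover have "card (torsion G n) = card (torsion H n)"
      by (rule card_torsion_pq_hom[OF assms(1,2) f])
    moreover have "card (torsion H n) \<noteq> 0"
      using assms(4) H.torsion_nonempty[of n] by (auto simp: torsion_def)
    ultimately show "card (torsion ?L n) = card (torsion ?K n)"
      by simp
  qed
  \<comment> \<open>Replacing \<open>?L\<close> by \<open>?K\<close> gives both products the same
    second factor, which can then be cancelled.\<close>
  then have "H \<times>\<times> ?L \<cong> H \<times>\<times> ?K"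
    by (rule H.DirProd_iso_trans[OF iso_refl])
  then have "G \<times>\<times> ?K \<cong> H \<times>\<times> ?K"
    by (rule iso_trans[OF GK_HL])
  then show ?thesis
    by (rule DirProd_cancel_right[OF assms(1,2) groups(1) assms(3,4) fin(1)])
qed

end
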